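(* Let $p\in[-1,1]$, $p\neq 0$. For any initial point $x^{(0)}\in S^4$ having exactly three zero coordinates (i.e. $0(x^{(0)})=3$), the set of limit points of the trajectory $\{W^n(x^{(0)})\}_{n\ge 0}$ is $$\omega(x^{(0)})=\{e_1,e_2,e_3,e_4,e_5\}.$$
   Context: $S^4=\{x=(x_1,\dots,x_5)\in\mathbb{R}^5: x_i\ge 0,\ \sum_{i=1}^5 x_i=1\}$. For $p\in[-1,1]$, the operator $W:S^4\to S^4$, $W(x)=x'$, is defined by $$\begin{aligned} x'_1&=x_5[1+p(x_1-x_2+x_3-x_4)],\\ x'_2&=x_1[1+p(x_2-x_3+x_4-x_5)],\\ x'_3&=x_2[1-p(x_1-x_3+x_4-x_5)],\\ x'_4&=x_3[1+p(x_1-x_2+x_4-x_5)],\\ x'_5&=x_4[1-p(x_1-x_2+x_3-x_5)]. \end{aligned}$$ $W^n$ is the $n$-th iterate of $W$. $e_i\in S^4$ is the $i$-th vertex (the $i$-th standard basis vector of $\mathbb{R}^5$). $0(x)$ denotes the number of zero coordinates of $x\in S^4$. $\omega(x^{(0)})$ denotes the set of limit points (subsequential limits) of $\{W^n(x^{(0)})\}_{n\ge0}$. *)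

theory Defs
  imports "HOL-Analysis.Analysis"
begin

definition S4 :: "(real ^ 5) set" where
  "S4 = {x. (\<forall>i. 0 \<le> x $ i) \<and> (\<Sum>i\<in>UNIV. x $ i) = 1}"

text \<open>The index type \<open>5\<close> is the integers modulo 5, so its elements are \<open>1, 2, 3, 4\<close>
  and \<open>5 = 0\<close>; the final \<open>else\<close> branch below is the coordinate with index \<open>5\<close>.\<close>

definition W :: "real \<Rightarrow> real ^ 5 \<Rightarrow> real ^ 5" where
  "W p x = (\<chi> i.
     if i = 1 then x $ 5 * (1 + p * (x $ 1 - x $ 2 + x $ 3 - x $ 4))
     else if i = 2 then x $ 1 * (1 + p * (x $ 2 - x $ 3 + x $ 4 - x $ 5))
     else if i = 3 then x $ 2 * (1 - p * (x $ 1 - x $ 3 + x $ 4 - x $ 5))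
     else if i = 4 then x $ 3 * (1 + p * (x $ 1 - x $ 2 + x $ 4 - x $ 5))
     else x $ 4 * (1 - p * (x $ 1 - x $ 2 + x $ 3 - x $ 5)))"

definition num_zeros :: "real ^ 5 \<Rightarrow> nat" where
  "num_zeros x = card {i. x $ i = 0}"

definition omega_limit :: "real \<Rightarrow> real ^ 5 \<Rightarrow> (real ^ 5) set" where
  "omega_limit p x =
     {y. \<exists>r :: nat \<Rightarrow> nat. strict_mono r \<and> (\<lambda>n. (W p ^^ r n) x) \<longlonglongrightarrow> y}"

lemma UNIV_5: "(UNIV :: 5 set) = {1, 2, 3, 4, 5}"
proof -
  have "card {1, 2, 3, 4, 5 :: 5} = CARD(5)" by simp
  then show ?thesis by (metis card_subset_eq finite_class.finite_UNIV subset_UNIV)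
qed

lemma sum_5: "sum f (UNIV :: 5 set) = f 1 + f 2 + f 3 + f 4 + f 5"
  unfolding UNIV_5 by (simp add: ac_simps)

lemma W_nth:
  "W p x $ 1 = x $ 5 * (1 + p * (x $ 1 - x $ 2 + x $ 3 - x $ 4))"
  "W p x $ 2 = x $ 1 * (1 + p * (x $ 2 - x $ 3 + x $ 4 - x $ 5))"
  "W p x $ 3 = x $ 2 * (1 - p * (x $ 1 - x $ 3 + x $ 4 - x $ 5))"
  "W p x $ 4 = x $ 3 * (1 + p * (x $ 1 - x $ 2 + x $ 4 - x $ 5))"
  "W p x $ 5 = x $ 4 * (1 - p * (x $ 1 - x $ 2 + x $ 3 - x $ 5))"
  by (simp_all add: W_def)

lemma W_S4:
  assumes p: "p \<in> {-1..1}" and x: "x \<in> S4"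
  shows "W p x \<in> S4"
proof -
  have nn: "0 \<le> x $ i" for i using x unfolding S4_def by blast
  have s: "x $ 1 + x $ 2 + x $ 3 + x $ 4 + x $ 5 = 1"
    using x unfolding S4_def sum_5 by simp
  have b: "\<bar>p * t\<bar> \<le> 1" if "\<bar>t\<bar> \<le> 1" for t
  proof -
    have "\<bar>p\<bar> \<le> 1" using p by auto
    then show ?thesis using that by (simp add: abs_mult mult_le_one)
  qed
  have a: "0 \<le> a * (1 + p * t)" "0 \<le> a * (1 - p * t)" if "0 \<le> a" "\<bar>t\<bar> \<le> 1" for a t
    using that b[OF that(2)] by (simp_all add: abs_le_iff mult_nonneg_nonneg)
  have n: "0 \<le> W p x $ 1" "0 \<le> W p x $ 2" "0 \<le> W p x $ 3" "0 \<le> W p x $ 4" "0 \<le> W p x $ 5"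
    unfolding W_nth by (rule a; use s nn[of 1] nn[of 2] nn[of 3] nn[of 4] nn[of 5] in linarith)+
  have "0 \<le> W p x $ i" for i
  proof -
    have "i \<in> {1, 2, 3, 4, 5}" using UNIV_5 by blast
    then show ?thesis using n by blast
  qed
  moreover have "W p x $ 1 + W p x $ 2 + W p x $ 3 + W p x $ 4 + W p x $ 5 =
      x $ 1 + x $ 2 + x $ 3 + x $ 4 + x $ 5"
    unfolding W_nth by algebra
  ultimately show ?thesis using s unfolding S4_def sum_5 by simp
qed

end

theory Submission
  imports Defs
begin

text \<open>Read the indices modulo 5. Then \<open>W p\<close> is equivariant under the cyclic shift of coordinates:
  the mass at \<open>i\<close> moves to \<open>i + 1\<close> and is multiplied by a factor whose form does not depend on \<open>i\<close>
  (\<open>W_nth_add_1\<close>). The interaction is a tournament on the indices mod 5: for \<open>p > 0\<close>, \<open>i\<close> gains from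
  \<open>i + 1\<close> and \<open>i + 3\<close> and loses to \<open>i + 2\<close> and \<open>i + 4\<close>; for \<open>p < 0\<close> the roles are exchanged.

  A point with three zero coordinates carries its mass on two indices. Both move one step at a time,
  so their difference is constant and the same one of them wins in every step. Its mass evolves by
  the scalar map \<open>u \<mapsto> u (1 + c (1 - u))\<close> with \<open>c = \<bar>p\<bar>\<close>, whose iterates
  converge to \<open>1\<close> (\<open>growth_iterates_tendsto_1\<close>). The trajectory is thus asymptotic to the vertex that
  travels around the cycle of length 5 (\<open>two_point_tracks_vertex\<close>), and the limit points of such a
  sequence are exactly the five vertices (\<open>limit_points_tracking_vertices\<close>).\<close>

lemma index_cases_5:
  fixes i :: 5
  obtains "i = 1" | "i = 2" | "i = 3" | "i = 4" | "i = 5"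
  using UNIV_5 UNIV_I[of i] by auto

text \<open>The five coordinate formulas of \<open>W\<close> are one formula, which makes the shift equivariance
  visible.\<close>

lemma W_nth_add_1:
  "W p x $ (i + 1) =
     x $ i * (1 + p * (x $ (i + 1) - x $ (i + 2) + x $ (i + 3) - x $ (i + 4)))"
proof -
  \<comment> \<open>Every sum of indices is reduced to one of the representatives \<open>1, 2, 3, 4, 5\<close> of \<open>W_nth\<close>.\<close>
  have mod5: "(6::5) = 1" "(7::5) = 2" "(8::5) = 3" "(9::5) = 4" "(0::5) = 5"
    by simp_all
  show ?thesis
    using W_nth[of p x]
    by (cases i rule: index_cases_5) (simp_all add: mod5 algebra_simps)
qed

text \<open>For \<open>p > 0\<close>, \<open>a\<close> gains from \<open>b\<close> in the first two alternatives and \<open>b\<close> from \<open>a\<close> in the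
  other two, so every pair of indices has a winner.\<close>

lemma distinct_indices_differ_by_1_or_3:
  fixes a b :: 5
  assumes "a \<noteq> b"
  shows "b = a + 1 \<or> b = a + 3 \<or> a = b + 1 \<or> a = b + 3"
  using assms by (cases a rule: index_cases_5; cases b rule: index_cases_5) simp_all

lemma W_two_point:
  fixes a b :: 5
  assumes "b = a + 1 \<or> b = a + 3"
  shows "W p (axis a u + axis b v) =
    axis (a + 1) (u * (1 + p * v)) + axis (b + 1) (v * (1 - p * u))"
    (is "?L = ?R")
proof -
  \<comment> \<open>Relative to \<open>a\<close>, all comparisons of indices are between numerals.\<close>
  have "?L $ (a + d + 1) = ?R $ (a + d + 1)" for d
    using assms unfolding W_nth_add_1
    by (cases d rule: index_cases_5; elim disjE) (simp_all add: axis_def add.assoc)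
  from this[of "_ - a - 1"] show ?thesis
    by (simp add: vec_eq_iff)
qed

definition growth :: "real \<Rightarrow> real \<Rightarrow> real" where
  "growth c u = u * (1 + c * (1 - u))"

text \<open>As long as the mass stays at or above its initial value \<open>u\<close>, the deficit from \<open>1\<close> shrinks in each
  step by a factor of at most \<open>1 - c * u < 1\<close>. The mass never decreases, so the convergence is
  geometric.\<close>

lemma growth_iterates_tendsto_1:
  assumes c: "0 < c" "c \<le> 1" and u: "0 < u" "u \<le> 1"
  shows "(\<lambda>n. (growth c ^^ n) u) \<longlonglongrightarrow> 1"
proof -
  define U where "U n = (growth c ^^ n) u" for n
  have bounds: "u \<le> U n \<and> U n \<le> 1 \<and> 1 - U n \<le> (1 - c * u) ^ n" for n
  proof (induction n)
    case 0
    then show ?case using u by (simp add: U_def)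
  next
    case (Suc n)
    have deficit: "1 - U (Suc n) = (1 - c * U n) * (1 - U n)"
      by (simp add: U_def growth_def algebra_simps)
    have cU: "c * u \<le> c * U n" "c * U n \<le> 1"
      using Suc.IH c u by (simp_all add: mult_le_one)
    have "(1 - c * U n) * (1 - U n) \<le> (1 - c * u) * (1 - c * u) ^ n"
      using cU Suc.IH by (intro mult_mono) auto
    moreover have "0 \<le> (1 - c * U n) * (1 - U n)"
      using cU Suc.IH by simp
    moreover have "(1 - c * U n) * (1 - U n) \<le> 1 * (1 - U n)"
      using cU Suc.IH c u by (intro mult_right_mono) (auto intro: order_trans[of 0 "c * u"])
    ultimately show ?case
      using deficit Suc.IH by simp
  qed
  have "c * u \<le> 1" using c u by (simp add: mult_le_one)
  then have "(\<lambda>n. (1 - c * u) ^ n) \<longlonglongrightarrow> 0"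
    using c u by (intro LIMSEQ_realpow_zero) auto
  then have lower: "(\<lambda>n. 1 - (1 - c * u) ^ n) \<longlonglongrightarrow> 1"
    using tendsto_diff[OF tendsto_const] by fastforce
  have "\<forall>\<^sub>F n in sequentially. 1 - (1 - c * u) ^ n \<le> U n"
    "\<forall>\<^sub>F n in sequentially. U n \<le> 1"
    using bounds by (auto simp: algebra_simps)
  then have "U \<longlonglongrightarrow> 1"
    by (rule tendsto_sandwich[OF _ _ lower tendsto_const])
  then show ?thesis by (simp add: U_def[abs_def])
qed

text \<open>For \<open>c > 0\<close> the hypothesis says that \<open>c = \<bar>p\<bar>\<close> and that \<open>a\<close> is the winning index: either
  \<open>p > 0\<close> and the tournament points from \<open>a\<close> to \<open>b\<close>, or \<open>p < 0\<close> and it points from \<open>b\<close> to \<open>a\<close>.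
  The difference of the two indices does not change, so the winner keeps winning.\<close>

lemma W_iterate_two_point:
  fixes a b :: 5
  assumes "(b = a + 1 \<or> b = a + 3) \<and> c = p \<or> (a = b + 1 \<or> a = b + 3) \<and> c = - p"
  shows "(W p ^^ n) (axis a u + axis b (1 - u)) =
    axis (a + of_nat n) ((growth c ^^ n) u) + axis (b + of_nat n) (1 - (growth c ^^ n) u)"
proof (induction n)
  case 0
  then show ?case by simp
next
  case (Suc n)
  define s t where "s = (growth c ^^ n) u" and "t = a + of_nat n"
  have step: "W p (axis t s + axis t' (1 - s)) =
      axis (t + 1) (growth c s) + axis (t' + 1) (1 - growth c s)"
    if "t' = b + of_nat n" for t'
  proof (cases "(b = a + 1 \<or> b = a + 3) \<and> c = p")
    case True
    then have "t' = t + 1 \<or> t' = t + 3"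
      using that by (auto simp: t_def algebra_simps)
    from W_two_point[OF this, of p s "1 - s"] True show ?thesis
      by (simp add: growth_def algebra_simps)
  next
    case False
    then have ab: "a = b + 1 \<or> a = b + 3" and c: "c = - p"
      using assms by auto
    then have "t = t' + 1 \<or> t = t' + 3"
      using that by (auto simp: t_def algebra_simps)
    from W_two_point[OF this, of p "1 - s" s] c show ?thesis
      by (simp add: growth_def algebra_simps)
  qed
  then show ?case
    using Suc.IH by (simp add: s_def t_def algebra_simps)
qed

lemma two_point_tracks_vertex:
  fixes a b :: 5
  assumes "(b = a + 1 \<or> b = a + 3) \<and> c = p \<or> (a = b + 1 \<or> a = b + 3) \<and> c = - p"
    and "0 < c" "c \<le> 1" "0 < u" "u \<le> 1"
  shows "(\<lambda>n. (W p ^^ n) (axis a u + axis b (1 - u)) - axis (a + of_nat n) 1) \<longlonglongrightarrow> 0"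
proof (rule Lim_null_comparison)
  define U where "U n = (growth c ^^ n) u" for n
  have "(W p ^^ n) (axis a u + axis b (1 - u)) - axis (a + of_nat n) 1 =
      (1 - U n) *\<^sub>R (axis (b + of_nat n) 1 - axis (a + of_nat n) 1)" for n
    unfolding W_iterate_two_point[OF assms(1)] U_def by (simp add: vec_eq_iff axis_def)
  moreover have "norm (axis i 1 - axis j 1 :: real ^ 5) \<le> 2" for i j
    using norm_triangle_ineq4[of "axis i 1 :: real ^ 5" "axis j 1"] by (simp add: norm_axis_1)
  ultimately show "\<forall>\<^sub>F n in sequentially.
      norm ((W p ^^ n) (axis a u + axis b (1 - u)) - axis (a + of_nat n) 1) \<le> \<bar>1 - U n\<bar> * 2"
    by (simp add: mult_left_mono)
  have "U \<longlonglongrightarrow> 1"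
    unfolding U_def[abs_def] using growth_iterates_tendsto_1 assms by blast
  then have "(\<lambda>n. \<bar>1 - U n\<bar> * 2) \<longlonglongrightarrow> \<bar>1 - 1\<bar> * 2"
    by (intro tendsto_intros)
  then show "(\<lambda>n. \<bar>1 - U n\<bar> * 2) \<longlonglongrightarrow> 0" by simp
qed

text \<open>A limit point of \<open>X\<close> is a limit of a sequence of vertices, hence a vertex since these form a
  finite, so closed, set. Conversely the times in one residue class modulo 5 single out one
  vertex.\<close>

lemma limit_points_tracking_vertices:
  fixes X :: "nat \<Rightarrow> real ^ 5" and a :: 5
  assumes X: "(\<lambda>n. X n - axis (a + of_nat n) 1) \<longlonglongrightarrow> 0"
  shows "{y. \<exists>r :: nat \<Rightarrow> nat. strict_mono r \<and> (\<lambda>n. X (r n)) \<longlonglongrightarrow> y} = range (\<lambda>k. axis k 1)"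
proof (intro subset_antisym subsetI)
  fix y assume "y \<in> {y. \<exists>r :: nat \<Rightarrow> nat. strict_mono r \<and> (\<lambda>n. X (r n)) \<longlonglongrightarrow> y}"
  then obtain r :: "nat \<Rightarrow> nat" where r: "strict_mono r" and y: "(\<lambda>n. X (r n)) \<longlonglongrightarrow> y"
    by blast
  have "(\<lambda>n. X (r n) - axis (a + of_nat (r n)) 1) \<longlonglongrightarrow> 0"
    using LIMSEQ_subseq_LIMSEQ[OF X r] by (simp add: o_def)
  from tendsto_diff[OF y this] have "(\<lambda>n. axis (a + of_nat (r n)) 1) \<longlonglongrightarrow> y" by simp
  moreover have "closed (range (\<lambda>k::5. axis k (1::real)))"
    by (intro finite_imp_closed) simp
  ultimately show "y \<in> range (\<lambda>k. axis k 1)"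
    by (intro closed_sequentially[of "range (\<lambda>k. axis k 1)" "\<lambda>n. axis (a + of_nat (r n)) 1" y]) auto
next
  fix y :: "real ^ 5" assume "y \<in> range (\<lambda>k. axis k 1)"
  then obtain k where y: "y = axis k 1" by blast
  have "\<exists>m::nat. of_nat m = k - a"
    by (cases "k - a" rule: index_cases_5) (metis of_nat_1 of_nat_numeral)+
  then obtain m :: nat where m: "of_nat m = k - a" by blast
  define r where "r n = 5 * n + m" for n
  have r: "strict_mono r" by (simp add: r_def strict_mono_def)
  have mod5: "(5::5) = 0" by simp
  have "of_nat (r n) = k - a" for n
    by (simp only: r_def of_nat_add of_nat_mult of_nat_numeral mod5 m mult_zero_left add_0_left)
  then have "a + of_nat (r n) = k" for n
    by simp
  then have "(\<lambda>n. X (r n) - axis k 1) \<longlonglongrightarrow> 0"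
    using LIMSEQ_subseq_LIMSEQ[OF X r] by (simp add: o_def)
  then have "(\<lambda>n. X (r n)) \<longlonglongrightarrow> y"
    unfolding y by (rule LIM_zero_cancel)
  with r show "y \<in> {y. \<exists>r :: nat \<Rightarrow> nat. strict_mono r \<and> (\<lambda>n. X (r n)) \<longlonglongrightarrow> y}" by blast
qed

lemma two_point_support_if_3_zeros:
  assumes "x \<in> S4" "num_zeros x = 3"
  obtains a b u where "a \<noteq> b" "0 < u" "u < 1" "x = axis a u + axis b (1 - u)"
proof -
  have "{i. x $ i \<noteq> 0} = UNIV - {i. x $ i = 0}" by auto
  then have "card {i. x $ i \<noteq> 0} = CARD(5) - num_zeros x"
    unfolding num_zeros_def by (simp only: card_Diff_subset[OF finite subset_UNIV])
  then have "card {i. x $ i \<noteq> 0} = 2"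
    using assms(2) by simp
  then obtain a b where ab: "{i. x $ i \<noteq> 0} = {a, b}" "a \<noteq> b"
    by (auto simp: card_2_iff)
  have x: "\<And>i. 0 \<le> x $ i" "(\<Sum>i\<in>UNIV. x $ i) = 1"
    using assms(1) by (auto simp: S4_def)
  have "(\<Sum>i\<in>UNIV. x $ i) = (\<Sum>i\<in>{a, b}. x $ i)"
    by (rule sum.mono_neutral_right) (use ab in auto)
  then have xb: "x $ b = 1 - x $ a" using x ab by simp
  have "x $ a \<noteq> 0" "x $ b \<noteq> 0" using ab by auto
  then have "0 < x $ a" "0 < x $ b" using x(1) by (simp_all add: less_le)
  moreover have "x = axis a (x $ a) + axis b (x $ b)"
    using ab by (auto simp: vec_eq_iff axis_def)
  ultimately show thesis
    using that[of a b "x $ a"] ab xb by simp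
qed

theorem theorem1:
  fixes p :: real and x0 :: "real ^ 5"
  assumes "p \<in> {-1..1}" and "p \<noteq> 0"
    and "x0 \<in> S4" and "num_zeros x0 = 3"
  shows "omega_limit p x0 = {axis 1 1, axis 2 1, axis 3 1, axis 4 1, axis 5 1}"
proof -
  obtain a b u where ab: "a \<noteq> b" and u: "0 < u" "u < 1"
    and x0: "x0 = axis a u + axis b (1 - u)"
    by (rule two_point_support_if_3_zeros[OF assms(3,4)])
  have x0': "x0 = axis b (1 - u) + axis a (1 - (1 - u))"
    by (simp add: x0 add.commute)
  have c: "0 < \<bar>p\<bar>" "\<bar>p\<bar> \<le> 1" using assms(1,2) by auto
  \<comment> \<open>The winner is \<open>a\<close> in the first alternative, \<open>b\<close> in the second.\<close>
  consider "(b = a + 1 \<or> b = a + 3) \<and> \<bar>p\<bar> = p \<or> (a = b + 1 \<or> a = b + 3) \<and> \<bar>p\<bar> = - p"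
    | "(a = b + 1 \<or> a = b + 3) \<and> \<bar>p\<bar> = p \<or> (b = a + 1 \<or> b = a + 3) \<and> \<bar>p\<bar> = - p"
    using distinct_indices_differ_by_1_or_3[OF ab] abs_if[of p] by presburger
  then obtain k where "(\<lambda>n. (W p ^^ n) x0 - axis (k + of_nat n) 1) \<longlonglongrightarrow> 0"
  proof cases
    case 1
    show thesis
      using two_point_tracks_vertex[OF 1 c u(1)] u(2) that unfolding x0 by (metis less_imp_le)
  next
    case 2
    have "0 < 1 - u" "1 - u \<le> 1" using u by auto
    from two_point_tracks_vertex[OF 2 c this] show thesis
      using that unfolding x0' by blast
  qed
  then have "omega_limit p x0 = range (\<lambda>k. axis k 1)"
    unfolding omega_limit_def by (rule limit_points_tracking_vertices)
  then show ?thesis unfolding UNIV_5 by simp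
qed

end
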